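(* Let $n\ge 6$ be an integer and write $n=7k-r$ with integers $k\ge 1$ and $0\le r\le 6$. Then a knight can survey the $n\times n$ board in at most \[14k^2-(2r+1)k-\min\{r,k-1\}-2\] days.
   Context: Cells of the $n\times n$ board are $(x,y)$ with $1\le x,y\le n$. A knight moves from $(x,y)$ to $(x',y')$ when $\{|x-x'|,|y-y'|\}=\{1,2\}$. A survey of the board in $m$ days by a piece is a sequence of cells $p_1,\dots,p_m$ such that for each $i<m$ the piece can move from $p_i$ to $p_{i+1}$ in one move, and every cell of the board either equals some $p_i$ or can be reached in one move of the piece from some $p_i$. The starting cell $p_1$ can be chosen freely. *)

theory Defs
  imports Main
begin

type_synonym cell = "int \<times> int"

definition board :: "int \<Rightarrow> cell set" where
  "board n = {1..n} \<times> {1..n}"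

definition knight_move :: "cell \<Rightarrow> cell \<Rightarrow> bool" where
  "knight_move p q \<longleftrightarrow> {\<bar>fst p - fst q\<bar>, \<bar>snd p - snd q\<bar>} = {1, 2}"

text \<open>A piece is given by its move relation. The sequence of cells is 0-indexed here;
  cells may repeat.\<close>

definition survey :: "(cell \<Rightarrow> cell \<Rightarrow> bool) \<Rightarrow> int \<Rightarrow> cell list \<Rightarrow> bool" where
  "survey move n ps \<longleftrightarrow>
     ps \<noteq> [] \<and> set ps \<subseteq> board n \<and>
     (\<forall>i. Suc i < length ps \<longrightarrow> move (ps ! i) (ps ! Suc i)) \<and>
     (\<forall>c\<in>board n. \<exists>p\<in>set ps. c = p \<or> move p c)"

definition can_survey_in :: "(cell \<Rightarrow> cell \<Rightarrow> bool) \<Rightarrow> int \<Rightarrow> nat \<Rightarrow> bool" where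
  "can_survey_in move n m \<longleftrightarrow> (\<exists>ps. length ps = m \<and> survey move n ps)"

end

theory Submission
  imports Defs
begin

text \<open>
  The walk visits, in each of \<open>k\<close> vertical strips, every cell of two columns \<open>a\<close> and \<open>a + 2\<close>
  outside the first and the last row. These cells dominate the seven full columns
  \<open>a - 2, \<dots>, a + 4\<close>, because from a column the knight reaches the columns at distance
  \<open>1\<close> and \<open>2\<close>, and the row that it needs above or below is always available on one of the two sides
  (\<open>strip_covers\<close>). The two columns split into two zigzags with steps \<open>(\<plusminus>2, \<plusminus>1)\<close>. The walk climbs
  one of them from \<open>(a, 2)\<close>, changes to the other at the top at the cost of one extra cell, and
  descends to \<open>(a + 2, 2)\<close> (\<open>successively_strip\<close>). So a strip takes \<open>2 (n - 2) + 1\<close> days.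

  The next strip is entered along the bottom of the board. If it begins seven columns further to
  the right, so that the dominated columns just fit together, this takes two cells in between;
  if the dominated columns of the two strips overlap in one column, a single cell is enough
  (\<open>successively_link\<close>). A board of width \<open>7k - r\<close> leaves room for \<open>min {r, k - 1}\<close> such overlaps, and
  so the total is
  \<open>k (2n - 3) + 2 (k - 1) - min {r, k - 1}\<close>, which is the bound. If \<open>r > k - 1\<close>, the width
  that is still in excess is removed at the left and right margins of the board, where up to two
  columns on each side hold no visited cell. This is insufficient only for \<open>n = 8\<close>, where the
  dominated columns of the two strips are made to overlap in three columns instead of one.
\<close>

section \<open>Knight moves\<close>

lemma knight_move_iff:
  "knight_move (x, y) (x', y') \<longleftrightarrow>
     \<bar>x - x'\<bar> = 1 \<and> \<bar>y - y'\<bar> = 2 \<or> \<bar>x - x'\<bar> = 2 \<and> \<bar>y - y'\<bar> = 1"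
  by (simp add: knight_move_def doubleton_eq_iff)

lemma knight_move_commute: "knight_move p q \<longleftrightarrow> knight_move q p"
  by (simp add: knight_move_def abs_minus_commute)

lemma survey_iff_successively:
  "survey move n ps \<longleftrightarrow>
     ps \<noteq> [] \<and> set ps \<subseteq> board n \<and> successively move ps \<and>
     (\<forall>c\<in>board n. \<exists>p\<in>set ps. c = p \<or> move p c)"
  by (simp add: survey_def successively_conv_nth)

section \<open>One strip of seven columns\<close>

definition zigzag :: "int \<Rightarrow> int \<Rightarrow> nat \<Rightarrow> cell list" where
  "zigzag a b h = map (\<lambda>j. (if even j then a else b, 2 + int j)) [0..<h]"

definition strip :: "nat \<Rightarrow> int \<Rightarrow> cell list" where
  "strip h a = zigzag a (a + 2) h @ [(a + 1, int h - 1)] @ rev (zigzag (a + 2) a h)"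

lemma zigzag_Suc:
  "zigzag a b (Suc h) = zigzag a b h @ [(if even h then a else b, 2 + int h)]"
  by (simp add: zigzag_def)

lemma length_zigzag [simp]: "length (zigzag a b h) = h"
  by (simp add: zigzag_def)

lemma zigzag_eq_Nil_iff [simp]: "zigzag a b h = [] \<longleftrightarrow> h = 0"
  by (simp add: zigzag_def)

lemma hd_zigzag: "0 < h \<Longrightarrow> hd (zigzag a b h) = (a, 2)"
  by (simp add: zigzag_def hd_map)

lemma last_zigzag: "0 < h \<Longrightarrow> last (zigzag a b h) = (if odd h then a else b, 1 + int h)"
  by (cases h) (auto simp: zigzag_Suc)

lemma successively_zigzag:
  assumes "\<bar>a - b\<bar> = 2"
  shows "successively knight_move (zigzag a b h)"
  using assms
  by (auto simp: successively_conv_nth zigzag_def knight_move_iff abs_minus_commute)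

lemma set_zigzag_subset: "set (zigzag a b h) \<subseteq> {a, b} \<times> {2..1 + int h}"
  by (auto simp: zigzag_def)

lemma zigzag_pair_covers_columns:
  assumes "x \<in> {a, b}" "2 \<le> y" "y \<le> 1 + int h"
  shows "(x, y) \<in> set (zigzag a b h) \<union> set (zigzag b a h)"
proof -
  have "(if even (nat (y - 2)) then a else b, y) \<in> set (zigzag a b h)"
    "(if even (nat (y - 2)) then b else a, y) \<in> set (zigzag b a h)"
    using assms by (auto simp: zigzag_def image_iff intro!: bexI[of _ "nat (y - 2)"])
  then show ?thesis using assms(1) by (auto split: if_splits)
qed

lemma length_strip [simp]: "length (strip h a) = 2 * h + 1"
  by (simp add: strip_def)

lemma strip_not_Nil [simp]: "strip h a \<noteq> []"
  by (simp add: strip_def)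

lemma hd_strip: "0 < h \<Longrightarrow> hd (strip h a) = (a, 2)"
  by (simp add: strip_def hd_zigzag)

lemma last_strip: "0 < h \<Longrightarrow> last (strip h a) = (a + 2, 2)"
  by (simp add: strip_def last_rev hd_zigzag)

text \<open>The two zigzags end in the same row, two columns apart. The extra cell lies midway between
  them and two rows below, so one move leads to it from either end, whatever the parity of \<open>h\<close>.\<close>

lemma successively_strip:
  assumes "0 < h"
  shows "successively knight_move (strip h a)"
proof -
  have "successively knight_move (rev (zigzag (a + 2) a h))"
    unfolding successively_rev
    using successively_zigzag[of "a + 2" a h]
    by (rule successively_mono) (simp_all add: knight_move_commute)
  then show ?thesis
    using assms
    by (simp add: strip_def successively_append_iff successively_Cons
        successively_zigzag last_zigzag hd_rev knight_move_iff)
qed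

lemma set_strip_subset:
  assumes "2 \<le> h"
  shows "set (strip h a) \<subseteq> {a..a + 2} \<times> {1..1 + int h}"
  using assms set_zigzag_subset[of a "a + 2" h] set_zigzag_subset[of "a + 2" a h]
  by (fastforce simp: strip_def)

lemma mem_strip:
  assumes "x = a \<or> x = a + 2" "2 \<le> y" "y \<le> 1 + int h"
  shows "(x, y) \<in> set (strip h a)"
  using zigzag_pair_covers_columns[of x a "a + 2" y h] assms by (auto simp: strip_def)

text \<open>A column other than the two visited ones lies at distance \<open>1\<close> or \<open>2\<close> from one of
  these, and is reached from two or one rows above or, near the top, below. An unvisited cell of a
  visited column lies in the first or the last row and is reached from the other visited
  column.\<close>

lemma strip_covers:
  assumes "4 \<le> h" "a - 2 \<le> x" "x \<le> a + 4" "1 \<le> y" "y \<le> 2 + int h"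
  shows "\<exists>p\<in>set (strip h a). (x, y) = p \<or> knight_move p (x, y)"
proof -
  have from_cell: ?thesis
    if "(u = a \<or> u = a + 2)" "2 \<le> v" "v \<le> 1 + int h" "(u, v) = (x, y) \<or> knight_move (u, v) (x, y)"
    for u v
    using mem_strip[OF that(1-3)] that(4) by (intro bexI[of _ "(u, v)"]) auto
  define s1 where "s1 = (if y \<le> int h then y + 1 else y - 1)"
  define s2 where "s2 = (if y \<le> int h - 1 then y + 2 else y - 2)"
  have s1: "2 \<le> s1" "s1 \<le> 1 + int h" "\<bar>s1 - y\<bar> = 1"
    and s2: "2 \<le> s2" "s2 \<le> 1 + int h" "\<bar>s2 - y\<bar> = 2"
    using assms by (auto simp: s1_def s2_def)
  consider "x = a - 2" | "x = a - 1" | "x = a" | "x = a + 1" | "x = a + 2" | "x = a + 3" | "x = a + 4"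
    using assms by linarith
  then show ?thesis
  proof cases
    case 1 then show ?thesis using from_cell[of a s1] s1 by (simp add: knight_move_iff)
  next
    case 2 then show ?thesis using from_cell[of a s2] s2 by (simp add: knight_move_iff)
  next
    case 3 then show ?thesis using from_cell[of "a + 2" s1] s1 by (simp add: knight_move_iff)
  next
    case 4 then show ?thesis using from_cell[of a s2] s2 by (simp add: knight_move_iff)
  next
    case 5 then show ?thesis using from_cell[of a s1] s1 by (simp add: knight_move_iff)
  next
    case 6 then show ?thesis using from_cell[of "a + 2" s2] s2 by (simp add: knight_move_iff)
  next
    case 7 then show ?thesis using from_cell[of "a + 2" s1] s1 by (simp add: knight_move_iff)
  qed
qed

section \<open>Joining the strips\<close>

text \<open>The cells between the last cell \<open>(a + 2, 2)\<close> of one strip and the first cell \<open>(b, 2)\<close> of the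
  next. The last case is meant for \<open>b = a + 4\<close>. Both \<open>b - (a + 2) = 2\<close> and
  \<open>b - (a + 2) = 4\<close> are even, which by the colouring of the board is necessary for a
  connection through a single cell.\<close>

definition link :: "int \<Rightarrow> int \<Rightarrow> cell list" where
  "link a b = (if b = a + 7 then [(a + 4, 3), (a + 6, 4)]
     else if b = a + 6 then [(a + 4, 3)] else [(a + 3, 4)])"

lemma successively_link:
  assumes "b - a \<in> {4, 6, 7}"
  shows "successively knight_move ((a + 2, 2) # link a b @ [(b, 2)])"
proof -
  consider "b = a + 4" | "b = a + 6" | "b = a + 7"
    using assms by (auto simp: algebra_simps)
  then show ?thesis by cases (simp_all add: link_def knight_move_iff)
qed

lemma link_not_Nil [simp]: "link a b \<noteq> []"
  by (simp add: link_def)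

fun tour :: "nat \<Rightarrow> (nat \<Rightarrow> int) \<Rightarrow> nat \<Rightarrow> cell list" where
  "tour h a 0 = strip h (a 0)"
| "tour h a (Suc i) = tour h a i @ link (a i) (a (Suc i)) @ strip h (a (Suc i))"

lemma tour_not_Nil [simp]: "tour h a i \<noteq> []"
  by (cases i) simp_all

lemma last_tour: "0 < h \<Longrightarrow> last (tour h a i) = (a i + 2, 2)"
  by (cases i) (simp_all add: last_strip)

lemma successively_tour:
  assumes "0 < h" "\<And>i. i < j \<Longrightarrow> a (Suc i) - a i \<in> {4, 6, 7}"
  shows "successively knight_move (tour h a j)"
  using assms(2)
proof (induction j)
  case 0
  then show ?case using assms(1) by (simp add: successively_strip)
next
  case (Suc j)
  have "successively knight_move (tour h a j)" using Suc by simp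
  moreover have "successively knight_move ((a j + 2, 2) # link (a j) (a (Suc j)) @ [(a (Suc j), 2)])"
    using Suc.prems by (intro successively_link) simp
  ultimately show ?case
    using assms(1) successively_strip[OF assms(1), of "a (Suc j)"]
    by (simp add: successively_append_iff successively_Cons last_tour hd_strip)
qed

lemma strip_subset_tour: "i \<le> j \<Longrightarrow> set (strip h (a i)) \<subseteq> set (tour h a j)"
  by (induction j) (auto simp: le_Suc_eq)

lemma set_tour_subset:
  assumes "3 \<le> h" "\<And>i. i < j \<Longrightarrow> a (Suc i) - a i \<in> {4, 6, 7}"
  shows "a 0 \<le> a j \<and> set (tour h a j) \<subseteq> {a 0..a j + 2} \<times> {1..1 + int h}"
  using assms(2)
proof (induction j)
  case 0
  then show ?case using set_strip_subset[of h "a 0"] assms(1) by simp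
next
  case (Suc j)
  have IH: "a 0 \<le> a j" "set (tour h a j) \<subseteq> {a 0..a j + 2} \<times> {1..1 + int h}"
    using Suc by auto
  consider "a (Suc j) = a j + 4" | "a (Suc j) = a j + 6" | "a (Suc j) = a j + 7"
    using Suc.prems[of j] by (auto simp: algebra_simps)
  then have le: "a j + 4 \<le> a (Suc j)"
    and "set (link (a j) (a (Suc j))) \<subseteq> {a j..a (Suc j) + 2} \<times> {1..1 + int h}"
    using assms(1) by (cases; auto simp: link_def)+
  moreover have "set (strip h (a (Suc j))) \<subseteq> {a (Suc j)..a (Suc j) + 2} \<times> {1..1 + int h}"
    using assms(1) by (intro set_strip_subset) simp
  ultimately show ?case using IH
    by (fastforce simp: subset_iff)
qed

lemma exists_strip:
  fixes a :: "nat \<Rightarrow> int"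
  assumes "\<And>i. i < j \<Longrightarrow> a (Suc i) - a i \<le> 7" "a 0 - 2 \<le> x" "x \<le> a j + 4"
  shows "\<exists>i\<le>j. a i - 2 \<le> x \<and> x \<le> a i + 4"
  using assms
proof (induction j)
  case (Suc j)
  show ?case
  proof (cases "x \<le> a j + 4")
    case True
    then show ?thesis using Suc by (metis le_SucI less_SucI)
  next
    case False
    then show ?thesis using Suc.prems(1)[of j] Suc.prems(3) by (intro exI[of _ "Suc j"]) auto
  qed
qed auto

lemma survey_tour:
  fixes a :: "nat \<Rightarrow> int"
  assumes "6 \<le> n"
    and gaps: "\<And>i. i < j \<Longrightarrow> a (Suc i) - a i \<in> {4, 6, 7}"
    and "a 0 \<in> {1..3}" and "a j + 2 \<in> {n - 2..n}"
  shows "survey knight_move n (tour (nat (n - 2)) a j)"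
proof -
  let ?h = "nat (n - 2)"
  have "set (tour ?h a j) \<subseteq> board n"
    using set_tour_subset[of ?h j a] assms by (fastforce simp: board_def)
  moreover have "successively knight_move (tour ?h a j)"
    using assms by (intro successively_tour) auto
  moreover have "\<exists>p\<in>set (tour ?h a j). (x, y) = p \<or> knight_move p (x, y)"
    if "(x, y) \<in> board n" for x y
  proof -
    have "a (Suc i) - a i \<le> 7" if "i < j" for i using gaps[OF that] by auto
    then obtain i where "i \<le> j" "a i - 2 \<le> x" "x \<le> a i + 4"
      using exists_strip[of j a x] assms \<open>(x, y) \<in> board n\<close> by (auto simp: board_def)
    then show ?thesis
      using strip_covers[of ?h "a i" x y] strip_subset_tour[of i j ?h a] assms that
      by (fastforce simp: board_def)
  qed
  ultimately show ?thesis by (auto simp: survey_iff_successively)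
qed

section \<open>Counting the days\<close>

lemma length_tour:
  "length (tour h a j) = Suc j * (2 * h + 1) + (\<Sum>i<j. if a (Suc i) = a i + 7 then 2 else 1)"
  by (induction j) (auto simp: link_def)

theorem mainTheorem3:
  fixes n k r :: int
  assumes "n \<ge> 6"
    and "n = 7 * k - r"
    and "k \<ge> 1"
    and "0 \<le> r" and "r \<le> 6"
  shows "\<exists>m. int m \<le> 14 * k^2 - (2 * r + 1) * k - min r (k - 1) - 2
             \<and> can_survey_in knight_move n m"
proof -
  define m where "m = min r (k - 1)"
  define j where "j = nat (k - 1)"
  have j: "int j = k - 1" using assms by (simp add: j_def)
  have m: "0 \<le> m" "m \<le> k - 1" using assms by (auto simp: m_def)
  have "\<exists>a. (\<forall>i<j. a (Suc i) - a i \<in> {4, 6, 7}) \<and> a 0 \<in> {1..3} \<and> a j + 2 \<in> {n - 2..n}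
    \<and> int (\<Sum>i<j. if a (Suc i) = a i + 7 then 2 else 1) = 2 * (k - 1) - m"
  proof (cases "k = 2 \<and> r = 6")
    case True
    then have "j = 1" "m = 1" "n = 8" using assms by (auto simp: j_def m_def)
    then show ?thesis using True by (intro exI[of _ "\<lambda>i. 1 + 4 * int i"]) auto
  next
    case False
    \<comment> \<open>The first \<open>m\<close> gaps are \<open>6\<close>, the others \<open>7\<close>. Of the remaining excess width, which is
      at most \<open>4\<close>, up to two columns are cut off at the left and the rest at the right.\<close>
    define t where "t = min 2 (r - m)"
    define a where "a i = 3 - t + 7 * int i - min (int i) m" for i :: nat
    have "r - m \<le> 4" using assms False by (auto simp: m_def min_def)
    then have "0 \<le> t" "t \<le> 2" "t \<le> r - m" "r - m \<le> t + 2"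
      using assms by (auto simp: t_def m_def)
    then have "a 0 \<in> {1..3}" "a j + 2 \<in> {n - 2..n}"
      using assms m by (auto simp: a_def j)
    moreover have gap: "a (Suc i) = a i + (if int i < m then 6 else 7)" for i
      using m by (auto simp: a_def)
    moreover have "int (\<Sum>i<l. if a (Suc i) = a i + 7 then 2 else 1) = 2 * int l - min (int l) m" for l
      using m by (induction l) (auto simp: gap)
    ultimately show ?thesis using j m by (intro exI[of _ a]) auto
  qed
  then obtain a where a: "\<And>i. i < j \<Longrightarrow> a (Suc i) - a i \<in> {4, 6, 7}" "a 0 \<in> {1..3}"
    "a j + 2 \<in> {n - 2..n}" "int (\<Sum>i<j. if a (Suc i) = a i + 7 then 2 else 1) = 2 * (k - 1) - m"
    by blast
  let ?ps = "tour (nat (n - 2)) a j"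
  have "survey knight_move n ?ps" using assms(1) a by (intro survey_tour) auto
  then have "can_survey_in knight_move n (length ?ps)" by (auto simp: can_survey_in_def)
  moreover have "int (length ?ps) = k * (2 * (n - 2) + 1) + (2 * (k - 1) - m)"
    using assms(1) j a(4) by (simp only: length_tour of_nat_add of_nat_mult) simp
  moreover have "\<dots> = 14 * k^2 - (2 * r + 1) * k - m - 2"
    unfolding assms(2) by (simp add: power2_eq_square algebra_simps)
  ultimately show ?thesis by (intro exI[of _ "length ?ps"]) (simp add: m_def)
qed

end
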